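(* For any integer $k \geq 2$, there is an integer $N_k$ such that for every $n \geq N_k$, there exists a $k$-dicritical oriented graph with $n$ vertices and $m$ arcs, such that $m \leq (2k-3)n$. Moreover, this last inequality is strict if $k>2$.
   Context: Digraphs are finite, have no loops and no parallel arcs; two opposite arcs are allowed. An oriented graph is a digraph with no pair of opposite arcs. A subdigraph $D'$ of $D$ satisfies $V(D')\subseteq V(D)$, $A(D')\subseteq A(D)$; it is proper if $V(D')\neq V(D)$ or $A(D')\neq A(D)$. A $k$-dicolouring of a digraph is a colouring of its vertices with colours in $\{1,\dots,k\}$ such that each colour class induces an acyclic subdigraph. The dichromatic number $\vec{\chi}(D)$ is the least $k$ such that $D$ has a $k$-dicolouring. $D$ is $k$-dicritical if $\vec{\chi}(D)=k$ and $\vec{\chi}(D')<k$ for every proper subdigraph $D'$ of $D$. *)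

theory Defs
  imports "Graph_Theory.Digraph_Component"
begin

text \<open>
  Digraphs are those of the locale \<^locale>\<open>digraph\<close>: finite, without loops or parallel arcs,
  but possibly with opposite arcs; subdigraphs are given by \<^const>\<open>subgraph\<close>.
\<close>

definition oriented_graph :: "('a, 'b) pre_digraph \<Rightarrow> bool" where
  "oriented_graph D \<longleftrightarrow> digraph D \<and> (\<forall>u v. u \<rightarrow>\<^bsub>D\<^esub> v \<longrightarrow> \<not> v \<rightarrow>\<^bsub>D\<^esub> u)"

text \<open>
  The walks underlying \<^const>\<open>pre_digraph.cycle\<close> follow the direction of the arcs, so these are
  directed cycles; a pair of opposite arcs is a cycle of length two.
\<close>

definition acyclic_digraph :: "('a, 'b) pre_digraph \<Rightarrow> bool" where
  "acyclic_digraph D \<longleftrightarrow> \<not> (\<exists>p. pre_digraph.cycle D p)"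

lemma (in wf_digraph) acyclic_digraph_iff_acyclic:
  "acyclic_digraph G \<longleftrightarrow> acyclic (arcs_ends G)"
proof
  assume *: "acyclic_digraph G"
  show "acyclic (arcs_ends G)"
  proof (rule acyclicI, intro allI notI)
    fix u assume "u \<rightarrow>\<^sup>+ u"
    then obtain p where "awalk u p u" "p \<noteq> []"
      unfolding reachable1_awalk by blast
    then have "closed_w p" by (auto simp: closed_w_def)
    then have "\<exists>c. cycle c" by (rule closed_w_imp_cycle)
    with * show False unfolding acyclic_digraph_def by blast
  qed
next
  assume *: "acyclic (arcs_ends G)"
  show "acyclic_digraph G" unfolding acyclic_digraph_def
  proof
    assume "\<exists>p. cycle p"
    then obtain u p where "awalk u p u" "p \<noteq> []" unfolding cycle_def by blast
    then have "u \<rightarrow>\<^sup>+ u" unfolding reachable1_awalk by blast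
    with * show False unfolding acyclic_def by blast
  qed
qed

definition dicolouring :: "('a, 'b) pre_digraph \<Rightarrow> nat \<Rightarrow> ('a \<Rightarrow> nat) \<Rightarrow> bool" where
  "dicolouring D k c \<longleftrightarrow>
     c ` verts D \<subseteq> {1..k} \<and>
     (\<forall>i \<in> {1..k}. acyclic_digraph (D \<restriction> {v \<in> verts D. c v = i}))"

definition dichromatic_number :: "('a, 'b) pre_digraph \<Rightarrow> nat" where
  "dichromatic_number D = (LEAST k. \<exists>c. dicolouring D k c)"

text \<open>
  In a finite loopless digraph an injective colouring is a dicolouring, so the
  \<^const>\<open>Least\<close> above is attained.
\<close>

lemma digraph_has_dicolouring:
  assumes "digraph D"
  shows "\<exists>k c. dicolouring D k c"
proof -
  interpret digraph D by fact
  obtain f :: "'a \<Rightarrow> nat" and n where f: "f ` verts D = {i. i < n}" "inj_on f (verts D)"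
    using finite_imp_inj_to_nat_seg[OF finite_verts] by blast
  let ?c = "\<lambda>v. Suc (f v)"
  have "acyclic_digraph (D \<restriction> {v \<in> verts D. ?c v = i})" for i
  proof -
    let ?H = "D \<restriction> {v \<in> verts D. ?c v = i}"
    interpret H: wf_digraph ?H by unfold_locales (auto simp: induce_subgraph_def)
    have "arcs_ends ?H = {}"
      by (auto simp: arcs_ends_conv induce_subgraph_def)
        (metis f(2) inj_onD no_loops head_in_verts tail_in_verts)
    then show ?thesis by (simp add: H.acyclic_digraph_iff_acyclic acyclic_def)
  qed
  moreover have "?c ` verts D \<subseteq> {1..n}"
    using f(1) by (fastforce simp: Suc_le_eq)
  ultimately have "dicolouring D n ?c" unfolding dicolouring_def by blast
  then show ?thesis by blast
qed

definition dicritical :: "nat \<Rightarrow> ('a, 'b) pre_digraph \<Rightarrow> bool" where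
  "dicritical k D \<longleftrightarrow>
     digraph D \<and> dichromatic_number D = k \<and>
     (\<forall>H. subgraph H D \<and> (verts H \<noteq> verts D \<or> arcs H \<noteq> arcs D) \<longrightarrow> dichromatic_number H < k)"

end

theory Submission
  imports Defs "HOL-Library.Countable"
begin

text \<open>
  The proof is by induction on \<open>k\<close>; directed cycles settle \<open>k = 2\<close>. For the step from \<open>q\<close> to
  \<open>q + 1\<close>, take vertices \<open>a\<^sub>0, \<dots>, a\<^sub>q\<close> and, for every pair \<open>i < j\<close>, a \<open>q\<close>-dicritical oriented graph
  \<open>A\<^sub>i\<^sub>j\<close>, all of these disjoint. Add the arc \<open>a\<^sub>j \<rightarrow> a\<^sub>i\<close>, all arcs from \<open>a\<^sub>i\<close> to \<open>A\<^sub>i\<^sub>j\<close> and all arcs from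
  \<open>A\<^sub>i\<^sub>j\<close> to \<open>a\<^sub>j\<close>. In a \<open>q\<close>-dicolouring every \<open>A\<^sub>i\<^sub>j\<close> uses all \<open>q\<close> colours, so if \<open>a\<^sub>i\<close> and \<open>a\<^sub>j\<close> had the
  same colour, there would be a monochromatic directed triangle \<open>a\<^sub>i \<rightarrow> x \<rightarrow> a\<^sub>j \<rightarrow> a\<^sub>i\<close>. The gadget thus
  acts as an edge between \<open>a\<^sub>i\<close> and \<open>a\<^sub>j\<close> and the whole as the complete graph on \<open>q + 1\<close> vertices,
  which is not \<open>q\<close>-colourable (\<open>blowup_not_colourable\<close>).

  Once an arc of the gadget of \<open>(i, j)\<close> is deleted, there is a \<open>q\<close>-dicolouring in which \<open>a\<^sub>i\<close> and \<open>a\<^sub>j\<close>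
  are the only two of the vertices \<open>a\<^sub>l\<close> with the same colour \<open>\<gamma>\<close>. If the deleted arc lies in \<open>A\<^sub>i\<^sub>j\<close>, the
  rest of \<open>A\<^sub>i\<^sub>j\<close> can avoid \<open>\<gamma>\<close>; if it joins \<open>x\<close> in \<open>A\<^sub>i\<^sub>j\<close> to \<open>a\<^sub>i\<close> or \<open>a\<^sub>j\<close>, then \<open>A\<^sub>i\<^sub>j\<close> has a
  \<open>q\<close>-dicolouring in which \<open>x\<close> alone has colour \<open>\<gamma>\<close>. In all cases \<open>blowup_acyclic\<close> shows that no
  monochromatic directed cycle remains, so the new oriented graph is \<open>(q + 1)\<close>-dicritical
  (\<open>critical_blowup\<close>).

  If \<open>A\<^sub>i\<^sub>j\<close> has \<open>t\<close> vertices and at most \<open>(2q - 3)t\<close> arcs, its gadget has at most \<open>(2q - 1)t + 1\<close> arcs.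
  With \<open>n\<close> vertices in total, the number of arcs is at most
  \<open>(2q - 1)(n - q - 1) + q(q + 1) < (2q - 1)n\<close>. The orders of the \<open>A\<^sub>i\<^sub>j\<close> can be any sufficiently
  large numbers, so every large \<open>n\<close> occurs.

  The construction is carried out for relations, seen as arc sets on their fields (dicritical
  digraphs have no isolated vertices when \<open>k \<ge> 2\<close>), and translated to digraphs at the end.
\<close>

section \<open>Acyclic relations\<close>

lemma acyclic_hom:
  assumes "acyclic S" "\<And>u v. (u, v) \<in> R \<Longrightarrow> (g u, g v) \<in> S"
  shows "acyclic R"
proof -
  have "(g u, g v) \<in> S\<^sup>+" if "(u, v) \<in> R\<^sup>+" for u v
    using that by induction (auto intro: assms(2) trancl_into_trancl)
  with assms(1) show ?thesis unfolding acyclic_def by blast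
qed

lemma acyclic_fibres:
  assumes "\<And>u v. (u, v) \<in> R \<Longrightarrow> r u = r v"
    and "\<And>i. acyclic {(u, v) \<in> R. r u = i \<and> r v = i}"
  shows "acyclic R"
proof (rule acyclicI, intro allI notI)
  fix x assume x: "(x, x) \<in> R\<^sup>+"
  have "r y = r x \<and> (x, y) \<in> {(u, v) \<in> R. r u = r x \<and> r v = r x}\<^sup>+"
    if "(x, y) \<in> R\<^sup>+" for y
    using that
  proof induction
    case (base y)
    then show ?case using assms(1)[OF base] by auto
  next
    case (step y z)
    then show ?case using assms(1)[OF step(2)]
      by (auto intro: trancl_into_trancl)
  qed
  with x assms(2)[of "r x"] show False unfolding acyclic_def by blast
qed

text \<open>
  A rank that never decreases along arcs is constant on a cycle, so only the arcs within a level
  matter.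
\<close>

lemma acyclic_rank:
  fixes r :: "'a \<Rightarrow> nat"
  assumes "\<And>u v. (u, v) \<in> R \<Longrightarrow> r u \<le> r v"
    and "acyclic {(u, v) \<in> R. r u = r v}"
  shows "acyclic R"
proof (rule acyclicI, intro allI notI)
  fix x assume x: "(x, x) \<in> R\<^sup>+"
  have "r x \<le> r y \<and> (r y = r x \<longrightarrow> (x, y) \<in> {(u, v) \<in> R. r u = r v}\<^sup>+)"
    if "(x, y) \<in> R\<^sup>+" for y
    using that
  proof induction
    case (base y)
    then show ?case using assms(1)[OF base] by auto
  next
    case (step y z)
    then show ?case using assms(1)[OF step(2)]
      by (auto intro: trancl_into_trancl)
  qed
  with x assms(2) show False unfolding acyclic_def by blast
qed

section \<open>Dicolourings of relations\<close>

text \<open>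
  The arcs with both ends of the same colour. A directed cycle in this relation has a single
  colour, so all colour classes are acyclic iff this relation is.
\<close>

definition monochromatic :: "('a \<times> 'a) set \<Rightarrow> ('a \<Rightarrow> 'b) \<Rightarrow> ('a \<times> 'a) set" where
  "monochromatic R c = {(u, v) \<in> R. c u = c v}"

text \<open>
  Existence of a \<open>k\<close>-dicolouring, with colours \<open>0, \<dots>, k - 1\<close>. The colouring is a total function;
  for \<open>k > 0\<close>, its values outside the field of \<open>R\<close> play no role.
\<close>

definition colourable :: "('a \<times> 'a) set \<Rightarrow> nat \<Rightarrow> bool" where
  "colourable R k \<longleftrightarrow> (\<exists>c :: 'a \<Rightarrow> nat. (\<forall>v. c v < k) \<and> acyclic (monochromatic R c))"

text \<open>
  \<open>k\<close>-dicritical oriented graphs given by their arc sets: for \<open>k \<ge> 2\<close>, it suffices to consider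
  the deletion of a single arc.
\<close>

definition critical :: "nat \<Rightarrow> ('a \<times> 'a) set \<Rightarrow> bool" where
  "critical k R \<longleftrightarrow> finite R \<and> (\<forall>u v. (u, v) \<in> R \<longrightarrow> (v, u) \<notin> R) \<and>
     \<not> colourable R (k - 1) \<and> (\<forall>e\<in>R. colourable (R - {e}) (k - 1))"

lemma colourable_from_set:
  fixes c :: "'a \<Rightarrow> 'c"
  assumes "finite S" "S \<noteq> {}" "card S \<le> k" "c ` Field R \<subseteq> S" "acyclic (monochromatic R c)"
  shows "colourable R k"
proof -
  obtain h where h: "inj_on h S" "h ` S = {..<card S}"
    using ex_bij_betw_finite_nat[OF assms(1)] by (auto simp: bij_betw_def atLeast0LessThan)
  let ?d = "\<lambda>v. if v \<in> Field R then h (c v) else 0"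
  have "card S > 0" using assms(1,2) by (simp add: card_gt_0_iff)
  moreover have "h (c v) < card S" if "v \<in> Field R" for v
    using that h(2) assms(4) by blast
  ultimately have "\<forall>v. ?d v < k" using assms(3) by (auto intro: less_le_trans)
  moreover have "monochromatic R ?d = monochromatic R c"
    using h(1) assms(4) unfolding monochromatic_def
    by (auto simp: FieldI1 FieldI2 inj_on_eq_iff[OF h(1)] image_subset_iff)
  ultimately show ?thesis using assms(5) unfolding colourable_def
    by (intro exI[of _ ?d]) (simp only: simp_thms)
qed

lemma colourable_into_set:
  assumes "colourable R k" "finite S" "card S = k"
  shows "\<exists>c. (\<forall>v. c v \<in> S) \<and> acyclic (monochromatic R c)"
proof -
  obtain c where c: "\<forall>v. c v < k" "acyclic (monochromatic R c)"
    using assms(1) unfolding colourable_def by blast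
  obtain h where h: "bij_betw h {..<k} S"
    using ex_bij_betw_nat_finite[OF assms(2)] assms(3) by (auto simp: atLeast0LessThan)
  have "monochromatic R (h \<circ> c) = monochromatic R c"
    using h c(1) unfolding monochromatic_def bij_betw_def by (auto simp: inj_on_eq_iff)
  moreover have "\<forall>v. (h \<circ> c) v \<in> S" using h c(1) by (auto simp: bij_betw_def)
  ultimately show ?thesis using c(2) by (intro exI[of _ "h \<circ> c"]) simp
qed

lemma critical_nonempty:
  assumes "critical k R" "k \<ge> 2"
  shows "R \<noteq> {}"
proof
  assume "R = {}"
  then have "colourable R (k - 1)" unfolding colourable_def monochromatic_def
    using assms(2) by (intro exI[of _ "\<lambda>_. 0"]) (auto simp: acyclic_def)
  with assms(1) show False by (simp add: critical_def)
qed

text \<open>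
  Delete an arc at \<open>x\<close>, colour the rest without the colour \<open>g\<close>, and recolour \<open>x\<close> with \<open>g\<close>.
\<close>

lemma critical_colour_vertex_alone:
  assumes "critical k R" "k \<ge> 2" "x \<in> Field R" "g < k"
  obtains c where "\<forall>v. c v < k" "\<forall>v. c v = g \<longleftrightarrow> v = x" "acyclic (monochromatic R c)"
proof -
  obtain e where e: "e \<in> R" "fst e = x \<or> snd e = x"
    using assms(3) by (force simp: Field_def)
  have "colourable (R - {e}) (k - 1)" using assms(1) e(1) by (simp add: critical_def)
  from colourable_into_set[OF this, of "{..<k} - {g}"] assms(4)
  obtain c where c: "\<forall>v. c v \<in> {..<k} - {g}" "acyclic (monochromatic (R - {e}) c)" by auto
  let ?c = "c(x := g)"
  have noloop: "fst e' \<noteq> snd e'" if "e' \<in> R" for e'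
    using assms(1) that by (cases e') (auto simp: critical_def)
  have "monochromatic R ?c \<subseteq> monochromatic (R - {e}) c"
  proof
    fix a assume a: "a \<in> monochromatic R ?c"
    obtain u v where uv: "a = (u, v)" by (cases a)
    have "(u, v) \<in> R" "?c u = ?c v" using a uv by (auto simp: monochromatic_def)
    moreover from this have "u \<noteq> x" "v \<noteq> x"
      using noloop[of "(u, v)"] c(1) by (auto split: if_splits)
    ultimately show "a \<in> monochromatic (R - {e}) c"
      using e(2) uv by (auto simp: monochromatic_def)
  qed
  then have "acyclic (monochromatic R ?c)" using c(2) acyclic_subset by blast
  moreover have "\<forall>v. ?c v < k" "\<forall>v. ?c v = g \<longleftrightarrow> v = x" using c(1) assms(4) by auto
  ultimately show thesis using that by blast
qed

lemma critical_colourable: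
  assumes "critical k R" "k \<ge> 2"
  shows "colourable R k"
proof -
  obtain x where "x \<in> Field R" using critical_nonempty[OF assms] by (auto simp: Field_def)
  moreover have "0 < k" using assms(2) by simp
  ultimately obtain c where "\<forall>v. c v < k" "acyclic (monochromatic R c)"
    by (rule critical_colour_vertex_alone[OF assms])
  then show ?thesis unfolding colourable_def by blast
qed

lemma colourable_hom:
  assumes "colourable S k" "\<And>u v. (u, v) \<in> R \<Longrightarrow> (g u, g v) \<in> S"
  shows "colourable R k"
proof -
  obtain c where c: "\<forall>v. c v < k" "acyclic (monochromatic S c)"
    using assms(1) unfolding colourable_def by blast
  have "acyclic (monochromatic R (c \<circ> g))"
    by (rule acyclic_hom[OF c(2), of _ g]) (auto simp: monochromatic_def assms(2))
  then show ?thesis using c(1) unfolding colourable_def by (intro exI[of _ "c \<circ> g"]) simp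
qed

lemma Field_map_prod: "Field (map_prod f f ` R) = f ` Field R"
  unfolding Field_def by force

lemma critical_rename:
  assumes "critical k R" "inj f"
  shows "critical k (map_prod f f ` R)"
proof -
  let ?g = "inv f"
  have g: "?g (f x) = x" for x using assms(2) by simp
  have "\<not> colourable (map_prod f f ` R) (k - 1)"
  proof
    assume "colourable (map_prod f f ` R) (k - 1)"
    then have "colourable R (k - 1)" by (rule colourable_hom[of _ _ _ f]) auto
    with assms(1) show False by (simp add: critical_def)
  qed
  moreover have "colourable (map_prod f f ` R - {map_prod f f e}) (k - 1)" if "e \<in> R" for e
  proof -
    have "colourable (R - {e}) (k - 1)" using assms(1) that by (simp add: critical_def)
    then show ?thesis
      by (rule colourable_hom[of _ _ _ ?g]) (auto simp: g)
  qed
  moreover have "(v, u) \<notin> map_prod f f ` R" if "(u, v) \<in> map_prod f f ` R" for u v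
    using that assms unfolding critical_def by (auto simp: inj_eq)
  ultimately show ?thesis using assms(1) unfolding critical_def by auto
qed

section \<open>Directed cycles\<close>

text \<open>
  The directed cycle \<open>0 \<rightarrow> 1 \<rightarrow> \<dots> \<rightarrow> n - 1 \<rightarrow> 0\<close>.
\<close>

definition dicycle :: "nat \<Rightarrow> (nat \<times> nat) set" where
  "dicycle n = insert (n - 1, 0) ((\<lambda>i. (i, Suc i)) ` {..<n - 1})"

lemma card_dicycle_le: "n \<ge> 1 \<Longrightarrow> card (dicycle n) \<le> n"
  unfolding dicycle_def by (rule card_insert_le_m1) (use card_image_le[of "{..<n - 1}"] in auto)

lemma Field_dicycle: "n \<ge> 2 \<Longrightarrow> Field (dicycle n) = {..<n}"
proof (rule set_eqI)
  fix x assume n: "n \<ge> 2"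
  show "x \<in> Field (dicycle n) \<longleftrightarrow> x \<in> {..<n}"
  proof
    assume "x \<in> {..<n}"
    then have "x = n - 1 \<or> x < n - 1" by auto
    then show "x \<in> Field (dicycle n)" by (auto simp: dicycle_def Field_def)
  qed (use n in \<open>auto simp: dicycle_def Field_def\<close>)
qed

lemma critical_dicycle:
  assumes n: "n \<ge> 3"
  shows "critical 2 (dicycle n)"
proof -
  have "\<not> colourable (dicycle n) 1"
  proof
    assume "colourable (dicycle n) 1"
    then have ac: "acyclic (dicycle n)" by (auto simp: colourable_def monochromatic_def)
    have "(0, i) \<in> (dicycle n)\<^sup>*" if "i \<le> n - 1" for i
      using that
    proof (induction i)
      case (Suc i)
      then have "(i, Suc i) \<in> dicycle n" by (auto simp: dicycle_def)
      with Suc show ?case by (auto intro: rtrancl_into_rtrancl)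
    qed simp
    then have "(0, n - 1) \<in> (dicycle n)\<^sup>*" by simp
    moreover have "(n - 1, 0) \<in> dicycle n" by (simp add: dicycle_def)
    ultimately have "(0, 0) \<in> (dicycle n)\<^sup>+" by (rule rtrancl_into_trancl1)
    with ac show False by (auto simp: acyclic_def)
  qed
  moreover have "colourable (dicycle n - {e}) 1" if "e \<in> dicycle n" for e
  proof -
    have "e = (n - 1, 0) \<or> (\<exists>i<n - 1. e = (i, Suc i))"
      using that by (auto simp: dicycle_def)
    moreover define j where "j = fst e"
    ultimately have j: "j < n" "e = (j, if j = n - 1 then 0 else Suc j)" using n by auto
    \<comment> \<open>Without its arc out of \<open>j\<close>, the cycle is a path from \<open>j + 1\<close> around to \<open>j\<close>, along which this
      rank increases.\<close>
    let ?r = "\<lambda>i. if i \<le> j then i + n else i"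
    have "?r u < ?r v" if "(u, v) \<in> dicycle n - {e}" for u v
      using that j n by (auto simp: dicycle_def split: if_splits)
    then have "acyclic (dicycle n - {e})"
      by (intro acyclic_hom[OF wf_acyclic[OF wf_less_than], of _ ?r]) (simp only: less_than_iff)
    moreover have "monochromatic (dicycle n - {e}) (\<lambda>_. 0 :: nat) = dicycle n - {e}"
      by (auto simp: monochromatic_def)
    ultimately show ?thesis unfolding colourable_def by (intro exI[of _ "\<lambda>_. 0"]) simp
  qed
  moreover have "(v, u) \<notin> dicycle n" if "(u, v) \<in> dicycle n" for u v
    using that n by (auto simp: dicycle_def)
  ultimately show ?thesis unfolding critical_def by (auto simp: dicycle_def)
qed

section \<open>Blowing up the edges of a complete graph\<close>

text \<open>
  The edges of the complete graph on \<open>{0, \<dots>, q}\<close>, each with its smaller end first.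
\<close>

definition pairs :: "nat \<Rightarrow> (nat \<times> nat) set" where
  "pairs q = {(i, j). i < j \<and> j \<le> q}"

text \<open>
  \<open>Inl i\<close> is the vertex \<open>a\<^sub>i\<close>, and \<open>Inr (p, x)\<close> is the vertex \<open>x\<close> of the copy that belongs to the pair
  \<open>p\<close>.
\<close>

type_synonym vertex = "nat + (nat \<times> nat) \<times> nat"

text \<open>
  The gadget replacing the edge \<open>p = (i, j)\<close>: the arc \<open>a\<^sub>j \<rightarrow> a\<^sub>i\<close>, a copy of \<open>R\<close>, all arcs from \<open>a\<^sub>i\<close> to
  the copy, and all arcs from the copy to \<open>a\<^sub>j\<close>.
\<close>

definition gadget :: "nat \<times> nat \<Rightarrow> (nat \<times> nat) set \<Rightarrow> (vertex \<times> vertex) set" where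
  "gadget p R =
     insert (Inl (snd p), Inl (fst p))
      ((\<lambda>x. (Inl (fst p), Inr (p, x))) ` Field R \<union>
       (\<lambda>x. (Inr (p, x), Inl (snd p))) ` Field R \<union>
       (\<lambda>(x, y). (Inr (p, x), Inr (p, y))) ` R)"

text \<open>
  The complete graph on \<open>a\<^sub>0, \<dots>, a\<^sub>q\<close> with every edge \<open>p\<close> replaced by the gadget built from \<open>A p\<close>.
\<close>

definition blowup :: "nat \<Rightarrow> (nat \<times> nat \<Rightarrow> (nat \<times> nat) set) \<Rightarrow> (vertex \<times> vertex) set" where
  "blowup q A = (\<Union>p\<in>pairs q. gadget p (A p))"

lemma
  assumes "finite R"
  shows card_gadget_le: "card (gadget p R) \<le> 1 + 2 * card (Field R) + card R"
    and finite_gadget: "finite (gadget p R)"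
proof -
  let ?X = "(\<lambda>x. (Inl (fst p), Inr (p, x))) ` Field R :: (vertex \<times> vertex) set"
  let ?Y = "(\<lambda>x. (Inr (p, x), Inl (snd p))) ` Field R :: (vertex \<times> vertex) set"
  let ?Z = "(\<lambda>(x, y). (Inr (p, x), Inr (p, y))) ` R :: (vertex \<times> vertex) set"
  have f: "finite (Field R)" using assms by (rule finite_Field)
  show "finite (gadget p R)" using f assms by (simp add: gadget_def)
  have "card (gadget p R) \<le> Suc (card (?X \<union> ?Y \<union> ?Z))"
    unfolding gadget_def by (rule card_insert_le_m1) auto
  moreover have "card (?X \<union> ?Y \<union> ?Z) \<le> card (?X \<union> ?Y) + card ?Z" by (rule card_Un_le)
  moreover have "card (?X \<union> ?Y) \<le> card ?X + card ?Y" by (rule card_Un_le)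
  moreover have "card ?X \<le> card (Field R)" "card ?Y \<le> card (Field R)" "card ?Z \<le> card R"
    using f assms by (auto intro!: card_image_le)
  ultimately show "card (gadget p R) \<le> 1 + 2 * card (Field R) + card R" by linarith
qed

lemma finite_pairs: "finite (pairs q)" and card_pairs_le: "card (pairs q) \<le> q * (q + 1)"
proof -
  have s: "pairs q \<subseteq> {..<q} \<times> {..q}" by (auto simp: pairs_def)
  then show "finite (pairs q)" by (rule finite_subset) simp
  have "card (pairs q) \<le> card ({..<q} \<times> {..q})" by (rule card_mono[OF _ s]) simp
  then show "card (pairs q) \<le> q * (q + 1)" by simp
qed

lemma blowup_cases:
  assumes "(u, v) \<in> blowup q A"
  obtains (closing) i j where "i < j" "j \<le> q" "u = Inl j" "v = Inl i"
  | (out) i j x where "i < j" "j \<le> q" "x \<in> Field (A (i, j))" "u = Inl i" "v = Inr ((i, j), x)"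
  | (into) i j x where "i < j" "j \<le> q" "x \<in> Field (A (i, j))" "u = Inr ((i, j), x)" "v = Inl j"
  | (inner) i j x y where "i < j" "j \<le> q" "(x, y) \<in> A (i, j)"
      "u = Inr ((i, j), x)" "v = Inr ((i, j), y)"
proof -
  obtain i j where ij: "i < j" "j \<le> q" and uv: "(u, v) \<in> gadget (i, j) (A (i, j))"
    using assms unfolding blowup_def pairs_def by blast
  from uv consider "u = Inl j" "v = Inl i"
    | x where "x \<in> Field (A (i, j))" "u = Inl i" "v = Inr ((i, j), x)"
    | x where "x \<in> Field (A (i, j))" "u = Inr ((i, j), x)" "v = Inl j"
    | x y where "(x, y) \<in> A (i, j)" "u = Inr ((i, j), x)" "v = Inr ((i, j), y)"
    unfolding gadget_def by force
  then show thesis using ij by cases (fact that)+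
qed

lemma blowup_memI:
  assumes "i < j" "j \<le> q"
  shows "(Inl j, Inl i) \<in> blowup q A"
    and "x \<in> Field (A (i, j)) \<Longrightarrow> (Inl i, Inr ((i, j), x)) \<in> blowup q A"
    and "x \<in> Field (A (i, j)) \<Longrightarrow> (Inr ((i, j), x), Inl j) \<in> blowup q A"
    and "(x, y) \<in> A (i, j) \<Longrightarrow> (Inr ((i, j), x), Inr ((i, j), y)) \<in> blowup q A"
proof -
  have "gadget (i, j) (A (i, j)) \<subseteq> blowup q A"
    using assms unfolding blowup_def pairs_def by blast
  then show "(Inl j, Inl i) \<in> blowup q A"
    and "x \<in> Field (A (i, j)) \<Longrightarrow> (Inl i, Inr ((i, j), x)) \<in> blowup q A"
    and "x \<in> Field (A (i, j)) \<Longrightarrow> (Inr ((i, j), x), Inl j) \<in> blowup q A"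
    and "(x, y) \<in> A (i, j) \<Longrightarrow> (Inr ((i, j), x), Inr ((i, j), y)) \<in> blowup q A"
    by (auto simp: gadget_def)
qed

lemma Field_blowup:
  assumes "q \<ge> 1"
  shows "Field (blowup q A) = Inl ` {..q} \<union> Inr ` (SIGMA p:pairs q. Field (A p))"
proof
  show "Field (blowup q A) \<subseteq> Inl ` {..q} \<union> Inr ` (SIGMA p:pairs q. Field (A p))"
    unfolding Field_def by (auto elim!: blowup_cases simp: pairs_def) (auto simp: Field_def)
  have "Inl i \<in> Field (blowup q A)" if "i \<le> q" for i
  proof (cases "i = 0")
    case True
    then show ?thesis using blowup_memI(1)[of 0 1 q A] assms by (auto intro: FieldI2)
  next
    case False
    then show ?thesis using blowup_memI(1)[of 0 i q A] that by (auto intro: FieldI1)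
  qed
  moreover have "Inr (p, x) \<in> Field (blowup q A)" if "p \<in> pairs q" "x \<in> Field (A p)" for p x
    using that by (cases p) (auto simp: pairs_def intro: FieldI2 blowup_memI(2))
  ultimately show "Inl ` {..q} \<union> Inr ` (SIGMA p:pairs q. Field (A p)) \<subseteq> Field (blowup q A)"
    by auto
qed

lemma card_Field_blowup:
  assumes "q \<ge> 1" "\<And>p. p \<in> pairs q \<Longrightarrow> finite (A p)"
  shows "card (Field (blowup q A)) = q + 1 + (\<Sum>p\<in>pairs q. card (Field (A p)))"
proof -
  have f: "finite (SIGMA p:pairs q. Field (A p))"
    using assms(2) by (intro finite_SigmaI finite_pairs finite_Field)
  have "card (Field (blowup q A)) = card (Inl ` {..q} :: vertex set)
      + card (Inr ` (SIGMA p:pairs q. Field (A p)) :: vertex set)"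
    unfolding Field_blowup[OF assms(1)] using f by (intro card_Un_disjoint) auto
  also have "\<dots> = q + 1 + (\<Sum>p\<in>pairs q. card (Field (A p)))"
    using finite_pairs assms(2) by (simp add: card_image finite_Field)
  finally show ?thesis .
qed

lemma card_blowup_le:
  assumes "\<And>p. p \<in> pairs q \<Longrightarrow> finite (A p)"
  shows "card (blowup q A) \<le> (\<Sum>p\<in>pairs q. 1 + 2 * card (Field (A p)) + card (A p))"
proof -
  have "card (blowup q A) \<le> (\<Sum>p\<in>pairs q. card (gadget p (A p)))"
    unfolding blowup_def by (rule card_UN_le[OF finite_pairs])
  also have "\<dots> \<le> (\<Sum>p\<in>pairs q. 1 + 2 * card (Field (A p)) + card (A p))"
    using assms by (intro sum_mono card_gadget_le)
  finally show ?thesis .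
qed

lemma blowup_not_colourable:
  assumes q: "q \<ge> 2" and A: "\<And>p. p \<in> pairs q \<Longrightarrow> \<not> colourable (A p) (q - 1)"
  shows "\<not> colourable (blowup q A) q"
proof
  assume "colourable (blowup q A) q"
  then obtain c where c: "\<forall>v. c v < q" and ac: "acyclic (monochromatic (blowup q A) c)"
    unfolding colourable_def by blast
  have "\<not> inj_on (\<lambda>l. c (Inl l)) {..q}"
  proof (rule pigeonhole)
    have "card ((\<lambda>l. c (Inl l)) ` {..q}) \<le> card {..<q}"
      by (rule card_mono) (use c in auto)
    then show "card ((\<lambda>l. c (Inl l)) ` {..q}) < card {..q}" by simp
  qed
  then obtain i j where ij: "i < j" "j \<le> q" "c (Inl i) = c (Inl j)"
    unfolding inj_on_def by (metis atMost_iff linorder_neqE_nat)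
  let ?g = "c (Inl j)"
  \<comment> \<open>A vertex of the copy with this colour would close a monochromatic triangle, so the copy uses at
    most \<open>q - 1\<close> colours.\<close>
  have avoid: "c (Inr ((i, j), x)) \<noteq> ?g" if x: "x \<in> Field (A (i, j))" for x
  proof
    assume e: "c (Inr ((i, j), x)) = ?g"
    let ?M = "monochromatic (blowup q A) c"
    have "(Inl i, Inr ((i, j), x)) \<in> ?M" "(Inr ((i, j), x), Inl j) \<in> ?M" "(Inl j, Inl i) \<in> ?M"
      using blowup_memI[OF ij(1,2)] x e ij(3) by (auto simp: monochromatic_def)
    then have "(Inl i, Inl i) \<in> ?M\<^sup>+" by (meson r_into_trancl' trancl_into_trancl)
    with ac show False by (auto simp: acyclic_def)
  qed
  have "colourable (A (i, j)) (q - 1)"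
  proof (rule colourable_from_set[where S = "{..<q} - {?g}" and c = "\<lambda>x. c (Inr ((i, j), x))"])
    show "acyclic (monochromatic (A (i, j)) (\<lambda>x. c (Inr ((i, j), x))))"
      by (rule acyclic_hom[OF ac, of _ "\<lambda>x. Inr ((i, j), x)"])
        (auto simp: monochromatic_def intro: blowup_memI ij)
    show "card ({..<q} - {?g}) \<le> q - 1" using c by simp
    then show "{..<q} - {?g} \<noteq> {}"
      using q c by (metis One_nat_def Suc_1 card.empty card_Diff_singleton card_lessThan
          diff_is_0_eq lessThan_iff not_less_eq_eq)
  qed (use avoid c in auto)
  with A[of "(i, j)"] ij show False by (simp add: pairs_def)
qed

text \<open>
  Among the vertices \<open>a\<^sub>l\<close>, only \<open>a\<^sub>i\<close> and \<open>a\<^sub>j\<close> may share a colour. By the assumption \<open>cut\<close>, no triangle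
  \<open>a\<^sub>i \<rightarrow> x \<rightarrow> a\<^sub>j \<rightarrow> a\<^sub>i\<close> is monochromatic: \<open>a\<^sub>j \<rightarrow> a\<^sub>i\<close> is missing, or \<open>a\<^sub>i \<rightarrow> x\<close> is missing for every \<open>x\<close> of the
  colour of \<open>a\<^sub>i\<close>, or \<open>x \<rightarrow> a\<^sub>j\<close> is missing for every such \<open>x\<close>. A monochromatic cycle would then lie
  inside one copy, which the assumption \<open>inner\<close> excludes.
\<close>

lemma blowup_acyclic:
  fixes c :: "vertex \<Rightarrow> nat"
  assumes E: "E \<subseteq> blowup q A" and ij: "i < j" "j \<le> q"
    and col: "\<And>l m. l < m \<Longrightarrow> m \<le> q \<Longrightarrow> c (Inl l) = c (Inl m) \<Longrightarrow> l = i \<and> m = j"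
    and inner: "\<And>p. p \<in> pairs q \<Longrightarrow>
      acyclic {(x, y). (Inr (p, x), Inr (p, y)) \<in> E \<and> c (Inr (p, x)) = c (Inr (p, y))}"
    and cut: "(Inl j, Inl i) \<notin> E \<or>
      (\<forall>x. c (Inr ((i, j), x)) = c (Inl i) \<longrightarrow> (Inl i, Inr ((i, j), x)) \<notin> E) \<or>
      (\<forall>x. c (Inr ((i, j), x)) = c (Inl i) \<longrightarrow> (Inr ((i, j), x), Inl j) \<notin> E)"
  shows "acyclic (monochromatic E c)"
proof -
  let ?I = "{(u, v) \<in> monochromatic E c. \<exists>p x y. u = Inr (p, x) \<and> v = Inr (p, y)}"
  let ?f = "\<lambda>v :: vertex. fst (projr v)"
  have I: "acyclic ?I"
  proof (rule acyclic_fibres[where r = ?f])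
    fix p
    show "acyclic {(u, v) \<in> ?I. ?f u = p \<and> ?f v = p}"
    proof (cases "p \<in> pairs q")
      case True
      show ?thesis
        by (rule acyclic_hom[OF inner[OF True], of _ "\<lambda>v. snd (projr v)"])
          (auto simp: monochromatic_def)
    next
      case False
      then have "{(u, v) \<in> ?I. ?f u = p \<and> ?f v = p} = {}"
        using E unfolding monochromatic_def by (fastforce elim!: blowup_cases simp: pairs_def)
      then show ?thesis by (simp only: acyclic_def trancl_empty) simp
    qed
  qed auto
  have *: "acyclic (monochromatic E c)"
    if r: "\<And>u v. (u, v) \<in> monochromatic E c \<Longrightarrow> (u, v) \<notin> ?I \<Longrightarrow> r u < r v"
      "\<And>p x y. (Inr (p, x), Inr (p, y)) \<in> monochromatic E c \<Longrightarrow> r (Inr (p, x)) = r (Inr (p, y))"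
    for r :: "vertex \<Rightarrow> nat"
  proof (rule acyclic_rank[where r = r])
    show "r u \<le> r v" if "(u, v) \<in> monochromatic E c" for u v
      using r that by (cases "(u, v) \<in> ?I") (auto simp: less_imp_le)
    have "{(u, v) \<in> monochromatic E c. r u = r v} \<subseteq> ?I" using r(1) by fastforce
    then show "acyclic {(u, v) \<in> monochromatic E c. r u = r v}" using I acyclic_subset by blast
  qed
  \<comment> \<open>Since \<open>l < m\<close> in \<open>a\<^sub>l \<rightarrow> A\<^sub>l\<^sub>m \<rightarrow> a\<^sub>m\<close>, this rank increases along all arcs that are neither inside a copy
    nor of the form \<open>a\<^sub>m \<rightarrow> a\<^sub>l\<close>; an arc of the latter form can be monochromatic only if it is
    \<open>a\<^sub>j \<rightarrow> a\<^sub>i\<close>.\<close>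
  let ?up = "case_sum (\<lambda>l. 2 * l) (\<lambda>(p, x). 2 * fst p + 1)"
  show ?thesis
  proof (cases "(Inl j, Inl i) \<in> E")
    case False
    show ?thesis
    proof (rule *[of ?up])
      fix u v assume uv: "(u, v) \<in> monochromatic E c" "(u, v) \<notin> ?I"
      then have "(u, v) \<in> blowup q A" using E by (auto simp: monochromatic_def)
      then show "?up u < ?up v"
      proof (cases rule: blowup_cases)
        case (closing l m)
        then have "l = i \<and> m = j" using col[of l m] uv by (auto simp: monochromatic_def)
        with closing uv False show ?thesis by (auto simp: monochromatic_def)
      qed (use uv in auto)
    qed auto
  next
    case True
    \<comment> \<open>Within the colour class of \<open>a\<^sub>i\<close>, the rank puts \<open>a\<^sub>j\<close> before \<open>a\<^sub>i\<close>, all copies with an arc to either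
      of them first, and all others last; the copy for \<open>(i, j)\<close> goes first or last according to which
      side is cut off.\<close>
    let ?t = "if \<forall>x. c (Inr ((i, j), x)) = c (Inl i) \<longrightarrow> (Inl i, Inr ((i, j), x)) \<notin> E
      then 0 else 3 :: nat"
    let ?mid = "case_sum (\<lambda>l. if l = j then 1 else 2)
      (\<lambda>(p, x). if p = (i, j) then ?t else if snd p = i \<or> snd p = j then 0 else 3)"
    let ?r = "\<lambda>v. if c v = c (Inl i) then ?mid v else ?up v"
    show ?thesis
    proof (rule *[of ?r])
      fix u v assume uv: "(u, v) \<in> monochromatic E c" "(u, v) \<notin> ?I"
      then have uvE: "(u, v) \<in> E" "c u = c v" by (auto simp: monochromatic_def)
      have cij: "l = i \<or> l = j" if "c (Inl l) = c (Inl i)" "l \<le> q" for l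
        using col[of l i] col[of i l] that ij by (cases l i rule: linorder_cases) auto
      from uvE(1) E have "(u, v) \<in> blowup q A" by auto
      then show "?r u < ?r v"
      proof (cases rule: blowup_cases)
        case (closing l m)
        then have "l = i \<and> m = j" using col[of l m] uvE by auto
        with closing uvE ij show ?thesis by auto
      next
        case (out l m x)
        show ?thesis
        proof (cases "c u = c (Inl i)")
          case True
          then have "l = i \<or> l = j" using cij[of l] out by auto
          then show ?thesis using out uvE True ij by auto
        qed (use out uvE in auto)
      next
        case (into l m x)
        show ?thesis
        proof (cases "c u = c (Inl i)")
          case True
          then have "m = i \<or> m = j" using cij[of m] into uvE by auto
          then show ?thesis using into uvE True ij cut \<open>(Inl j, Inl i) \<in> E\<close> by auto
        qed (use into uvE in auto)
      qed (use uv in auto)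
    qed (auto simp: monochromatic_def)
  qed
qed

lemma ex_colouring_identifying_two:
  fixes q :: nat
  assumes "i < j" "j \<le> q"
  obtains f :: "nat \<Rightarrow> nat" where "f i = f j" "\<forall>l\<le>q. f l < q"
    "\<forall>l m. l < m \<longrightarrow> m \<le> q \<longrightarrow> f l = f m \<longrightarrow> l = i \<and> m = j"
proof -
  let ?f = "\<lambda>l. if l = j then i else if l > j then l - 1 else l"
  have "l = i \<and> m = j" if "l < m" "m \<le> q" "?f l = ?f m" for l m
    using that assms by (cases "l < j"; cases "l = j"; cases "m < j"; cases "m = j") simp_all
  moreover have "?f l < q" if "l \<le> q" for l
    using that assms by (cases "l < j"; cases "l = j") simp_all
  moreover have "?f i = ?f j" using assms by simp
  ultimately show thesis by (intro that[of ?f]) blast+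
qed

lemma critical_blowup:
  assumes q: "q \<ge> 2" and A: "\<And>p. p \<in> pairs q \<Longrightarrow> critical q (A p)"
  shows "critical (Suc q) (blowup q A)"
proof -
  let ?B = "blowup q A"
  have fin: "finite ?B" unfolding blowup_def
    using A finite_pairs by (auto simp: critical_def intro!: finite_gadget)
  have asy: "(v, u) \<notin> ?B" if "(u, v) \<in> ?B" for u v
    using that
  proof (cases rule: blowup_cases)
    case (inner i j x y)
    then have "(y, x) \<notin> A (i, j)" using A[of "(i, j)"] by (auto simp: critical_def pairs_def)
    with inner show ?thesis by (auto elim!: blowup_cases)
  qed (auto elim!: blowup_cases)
  have "\<exists>g. \<forall>p\<in>pairs q. (\<forall>x. g p x < q) \<and> acyclic (monochromatic (A p) (g p))"
    using critical_colourable[OF A q] unfolding colourable_def by metis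
  then obtain g where g: "\<And>p x. p \<in> pairs q \<Longrightarrow> g p x < q"
    "\<And>p. p \<in> pairs q \<Longrightarrow> acyclic (monochromatic (A p) (g p))" by metis
  \<comment> \<open>The common part of the cases below: \<open>f\<close> colours the vertices \<open>a\<^sub>l\<close>, \<open>h\<close> colours the copy for
    \<open>(i, j)\<close>, and \<open>g\<close> all other copies.\<close>
  have main: "colourable (?B - {e}) q"
    if ij: "i < j" "j \<le> q" and f: "f i = f j" "\<forall>l\<le>q. f l < q"
        "\<forall>l m. l < m \<longrightarrow> m \<le> q \<longrightarrow> f l = f m \<longrightarrow> l = i \<and> m = j"
      and h: "\<forall>x. h x < q"
      and ac: "acyclic {(x, y) \<in> A (i, j). (Inr ((i, j), x), Inr ((i, j), y)) \<noteq> e \<and> h x = h y}"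
      and cut: "(Inl j, Inl i) = e \<or>
        (\<forall>x\<in>Field (A (i, j)). h x = f i \<longrightarrow> (Inl i, Inr ((i, j), x)) = e) \<or>
        (\<forall>x\<in>Field (A (i, j)). h x = f i \<longrightarrow> (Inr ((i, j), x), Inl j) = e)"
    for i j e f h
  proof -
    let ?c = "case_sum f (\<lambda>(p, x). (g((i, j) := h)) p x)"
    have inFA: "x \<in> Field (A p)" "p \<in> pairs q" if "(Inl l, Inr (p, x)) \<in> ?B" for l p x
      using that by (auto elim!: blowup_cases simp: pairs_def)
    have inFA': "x \<in> Field (A p)" "p \<in> pairs q" if "(Inr (p, x), Inl l) \<in> ?B" for l p x
      using that by (auto elim!: blowup_cases simp: pairs_def)
    have "acyclic (monochromatic (?B - {e}) ?c)"
    proof (rule blowup_acyclic[OF _ ij])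
      fix p assume p: "p \<in> pairs q"
      have sub: "(x, y) \<in> A p" if "(Inr (p, x), Inr (p, y)) \<in> ?B" for x y
        using that by (auto elim!: blowup_cases)
      show "acyclic {(x, y). (Inr (p, x), Inr (p, y)) \<in> ?B - {e} \<and> ?c (Inr (p, x)) = ?c (Inr (p, y))}"
      proof (cases "p = (i, j)")
        case True
        show ?thesis by (rule acyclic_subset[OF ac]) (use True sub in auto)
      next
        case False
        show ?thesis by (rule acyclic_subset[OF g(2)[OF p]]) (use False sub in \<open>auto simp: monochromatic_def\<close>)
      qed
    next
      show "(Inl j, Inl i) \<notin> ?B - {e} \<or>
      (\<forall>x. ?c (Inr ((i, j), x)) = ?c (Inl i) \<longrightarrow> (Inl i, Inr ((i, j), x)) \<notin> ?B - {e}) \<or>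
      (\<forall>x. ?c (Inr ((i, j), x)) = ?c (Inl i) \<longrightarrow> (Inr ((i, j), x), Inl j) \<notin> ?B - {e})"
        using cut inFA(1)[of i "(i, j)"] inFA'(1)[of "(i, j)" _ j] by auto
    qed (use f(3) in auto)
    moreover have "?c ` Field (?B - {e}) \<subseteq> {..<q}"
    proof -
      have "Field (?B - {e}) \<subseteq> Field ?B" by (rule mono_Field) auto
      moreover have "?c v < q" if "v \<in> Field ?B" for v
        using that Field_blowup[of q A] q f(2) g(1) h by (cases v) (auto split: if_splits)
      ultimately show ?thesis by blast
    qed
    moreover have "{..<q} \<noteq> {}" using q by (auto simp: lessThan_empty_iff)
    ultimately show ?thesis
      by (intro colourable_from_set[of "{..<q}" q ?c]) simp_all
  qed
  have "colourable (?B - {e}) q" if e: "e \<in> ?B" for e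
  proof -
    obtain u v where uv: "e = (u, v)" by (cases e)
    from e uv have "(u, v) \<in> ?B" by simp
    then show ?thesis
    proof (cases rule: blowup_cases)
      case (closing i j)
      from closing(1,2) obtain f where f: "f i = f j" "\<forall>l\<le>q. f l < q"
        "\<forall>l m. l < m \<longrightarrow> m \<le> q \<longrightarrow> f l = f m \<longrightarrow> l = i \<and> m = j"
        by (rule ex_colouring_identifying_two)
      have p: "(i, j) \<in> pairs q" using closing by (simp add: pairs_def)
      show ?thesis
      proof (rule main[OF closing(1,2) f, of "g (i, j)"])
        show "acyclic {(x, y) \<in> A (i, j). (Inr ((i, j), x), Inr ((i, j), y)) \<noteq> e \<and>
            g (i, j) x = g (i, j) y}"
          by (rule acyclic_subset[OF g(2)[OF p]]) (auto simp: monochromatic_def)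
      qed (use g(1)[OF p] closing(3,4) uv in simp_all)
    next
      case (out i j x)
      from out(1,2) obtain f where f: "f i = f j" "\<forall>l\<le>q. f l < q"
        "\<forall>l m. l < m \<longrightarrow> m \<le> q \<longrightarrow> f l = f m \<longrightarrow> l = i \<and> m = j"
        by (rule ex_colouring_identifying_two)
      have p: "(i, j) \<in> pairs q" using out by (simp add: pairs_def)
      have "f i < q" using f(2) out(1,2) by simp
      with A[OF p] q out(3) obtain h where h: "\<forall>v. h v < q" "\<forall>v. h v = f i \<longleftrightarrow> v = x"
        "acyclic (monochromatic (A (i, j)) h)"
        by (rule critical_colour_vertex_alone)
      show ?thesis
      proof (rule main[OF out(1,2) f h(1)])
        show "acyclic {(x, y) \<in> A (i, j). (Inr ((i, j), x), Inr ((i, j), y)) \<noteq> e \<and> h x = h y}"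
          by (rule acyclic_subset[OF h(3)]) (auto simp: monochromatic_def)
      qed (use h(2) out(4,5) uv in simp)
    next
      case (into i j x)
      from into(1,2) obtain f where f: "f i = f j" "\<forall>l\<le>q. f l < q"
        "\<forall>l m. l < m \<longrightarrow> m \<le> q \<longrightarrow> f l = f m \<longrightarrow> l = i \<and> m = j"
        by (rule ex_colouring_identifying_two)
      have p: "(i, j) \<in> pairs q" using into by (simp add: pairs_def)
      have "f i < q" using f(2) into(1,2) by simp
      with A[OF p] q into(3) obtain h where h: "\<forall>v. h v < q" "\<forall>v. h v = f i \<longleftrightarrow> v = x"
        "acyclic (monochromatic (A (i, j)) h)"
        by (rule critical_colour_vertex_alone)
      show ?thesis
      proof (rule main[OF into(1,2) f h(1)])
        show "acyclic {(x, y) \<in> A (i, j). (Inr ((i, j), x), Inr ((i, j), y)) \<noteq> e \<and> h x = h y}"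
          by (rule acyclic_subset[OF h(3)]) (auto simp: monochromatic_def)
      qed (use h(2) into(4,5) uv in simp)
    next
      case (inner i j x y)
      from inner(1,2) obtain f where f: "f i = f j" "\<forall>l\<le>q. f l < q"
        "\<forall>l m. l < m \<longrightarrow> m \<le> q \<longrightarrow> f l = f m \<longrightarrow> l = i \<and> m = j"
        by (rule ex_colouring_identifying_two)
      have p: "(i, j) \<in> pairs q" using inner by (simp add: pairs_def)
      have fi: "f i < q" using f(2) inner(1,2) by simp
      have "colourable (A (i, j) - {(x, y)}) (q - 1)"
        using A[OF p] inner by (simp add: critical_def)
      from colourable_into_set[OF this, of "{..<q} - {f i}"] fi
      obtain h where h: "\<forall>v. h v \<in> {..<q} - {f i}" "acyclic (monochromatic (A (i, j) - {(x, y)}) h)"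
        by auto
      show ?thesis
      proof (rule main[OF inner(1,2) f, of h])
        show "acyclic {(x, y) \<in> A (i, j). (Inr ((i, j), x), Inr ((i, j), y)) \<noteq> e \<and> h x = h y}"
          by (rule acyclic_subset[OF h(2)]) (use inner(4,5) uv in \<open>auto simp: monochromatic_def\<close>)
      qed (use h(1) in auto)
    qed
  qed
  moreover have "\<not> colourable ?B q"
    using A by (intro blowup_not_colourable[OF q]) (simp add: critical_def)
  ultimately show ?thesis using fin asy unfolding critical_def by auto
qed

section \<open>Sparse critical relations of every large order\<close>

text \<open>
  All of the excess over \<open>N\<close> is given to one element.
\<close>

lemma ex_sizes:
  fixes N :: nat
  assumes "finite P" "P \<noteq> {}" "s \<ge> card P * N"
  shows "\<exists>t. (\<forall>p\<in>P. t p \<ge> N) \<and> sum t P = s"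
proof -
  obtain p0 where p0: "p0 \<in> P" using assms(2) by blast
  let ?t = "\<lambda>p. N + (if p = p0 then s - card P * N else 0)"
  have "sum ?t P = s" using assms p0 by (simp add: sum.distrib)
  then show ?thesis by (intro exI[of _ ?t]) auto
qed

lemma ex_sparse_critical:
  assumes "k \<ge> 2"
  shows "\<exists>N. \<forall>n\<ge>N. \<exists>A :: (nat \<times> nat) set. critical k A \<and> card (Field A) = n \<and>
    int (card A) \<le> (2 * int k - 3) * int n \<and>
    (k > 2 \<longrightarrow> int (card A) < (2 * int k - 3) * int n)"
  using assms
proof (induction k rule: dec_induct)
  case base
  show ?case
    by (rule exI[of _ 3], intro allI impI, rule_tac x = "dicycle n" in exI)
      (use card_dicycle_le in \<open>auto simp: critical_dicycle Field_dicycle\<close>)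
next
  case (step q)
  then obtain N where N: "\<And>n. n \<ge> N \<Longrightarrow> \<exists>A :: (nat \<times> nat) set. critical q A \<and>
    card (Field A) = n \<and> int (card A) \<le> (2 * int q - 3) * int n" by blast
  let ?P = "pairs q"
  have "(0, 1) \<in> ?P" using step(1) by (simp add: pairs_def)
  then have P: "?P \<noteq> {}" by blast
  show ?case
  proof (intro exI[of _ "q + 1 + card ?P * N"] allI impI)
    fix n assume n: "n \<ge> q + 1 + card ?P * N"
    then have "card ?P * N \<le> n - (q + 1)" by simp
    from ex_sizes[OF finite_pairs P this]
    obtain t where t: "\<forall>p\<in>?P. t p \<ge> N" "sum t ?P = n - (q + 1)" by blast
    have "\<forall>p\<in>?P. \<exists>A :: (nat \<times> nat) set. critical q A \<and>
      card (Field A) = t p \<and> int (card A) \<le> (2 * int q - 3) * int (t p)"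
      using N t(1) by blast
    then obtain A :: "nat \<times> nat \<Rightarrow> (nat \<times> nat) set" where A: "\<And>p. p \<in> ?P \<Longrightarrow> critical q (A p)"
      "\<And>p. p \<in> ?P \<Longrightarrow> card (Field (A p)) = t p"
      "\<And>p. p \<in> ?P \<Longrightarrow> int (card (A p)) \<le> (2 * int q - 3) * int (t p)"
      by metis
    have fin: "finite (A p)" if "p \<in> ?P" for p using A(1)[OF that] by (simp add: critical_def)
    let ?B = "blowup q A" and ?C = "map_prod to_nat to_nat ` blowup q A"
    have crit: "critical (Suc q) ?C"
      by (intro critical_rename critical_blowup step(1) A(1) inj_to_nat)
    have "card (Field ?C) = card (Field ?B)"
      by (simp add: Field_map_prod card_image)
    also have "\<dots> = q + 1 + (\<Sum>p\<in>?P. t p)"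
      using card_Field_blowup[of q A] fin A(2) step(1) by simp
    finally have order: "card (Field ?C) = n" using t(2) n by simp
    have "card ?C \<le> card ?B"
      using critical_blowup[OF step(1) A(1)] by (intro card_image_le) (simp add: critical_def)
    also have "\<dots> \<le> (\<Sum>p\<in>?P. 1 + 2 * card (Field (A p)) + card (A p))"
      using fin by (rule card_blowup_le)
    finally have "int (card ?C) \<le> int (\<Sum>p\<in>?P. 1 + 2 * card (Field (A p)) + card (A p))"
      by (rule of_nat_mono)
    also have "\<dots> = (\<Sum>p\<in>?P. 1 + 2 * int (card (Field (A p))) + int (card (A p)))"
      by (simp add: add.assoc)
    also have "\<dots> \<le> (\<Sum>p\<in>?P. 1 + (2 * int q - 1) * int (t p))"
      using A(2,3) by (intro sum_mono) (auto simp: algebra_simps)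
    also have "\<dots> = int (card ?P) + (2 * int q - 1) * int (sum t ?P)"
      by (simp add: sum.distrib sum_distrib_left)
    also have "\<dots> = int (card ?P) + (2 * int q - 1) * (int n - (int q + 1))"
      using t(2) n by (simp add: of_nat_diff)
    also have "\<dots> < (2 * int q - 1) * int n"
    proof -
      have "int (card ?P) \<le> int q * (int q + 1)"
        using of_nat_mono[OF card_pairs_le[of q], where 'a = int] by (simp add: algebra_simps)
      also have "\<dots> < (2 * int q - 1) * (int q + 1)"
        using step(1) by (intro mult_strict_right_mono) auto
      finally show ?thesis by (simp add: algebra_simps)
    qed
    finally have "int (card ?C) < (2 * int (Suc q) - 3) * int n" by simp
    then show "\<exists>A :: (nat \<times> nat) set. critical (Suc q) A \<and> card (Field A) = n \<and>
        int (card A) \<le> (2 * int (Suc q) - 3) * int n \<and>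
        (Suc q > 2 \<longrightarrow> int (card A) < (2 * int (Suc q) - 3) * int n)"
      using crit order by (intro exI[of _ ?C]) auto
  qed
qed

section \<open>From relations to digraphs\<close>

text \<open>
  The digraph with vertex set \<open>V\<close> whose arcs are the pairs in \<open>R\<close>.
\<close>

definition rel_digraph :: "'a set \<Rightarrow> ('a \<times> 'a) set \<Rightarrow> ('a, 'a \<times> 'a) pre_digraph" where
  "rel_digraph V R = \<lparr>verts = V, arcs = R, tail = fst, head = snd\<rparr>"

lemma wf_rel_digraph: "Field R \<subseteq> V \<Longrightarrow> wf_digraph (rel_digraph V R)"
  by unfold_locales (force simp: rel_digraph_def Field_def)+

lemma dicolouring_rel_digraph_iff:
  assumes "Field R \<subseteq> V"
  shows "dicolouring (rel_digraph V R) k c \<longleftrightarrow> c ` V \<subseteq> {1..k} \<and> acyclic (monochromatic R c)"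
proof -
  let ?D = "rel_digraph V R"
  interpret wf_digraph ?D using assms by (rule wf_rel_digraph)
  have ends: "arcs_ends (?D \<restriction> {v \<in> verts ?D. c v = i}) = {(u, v) \<in> monochromatic R c. c u = i \<and> c v = i}"
    for i
    using assms
    by (force simp: arcs_ends_conv induce_subgraph_def rel_digraph_def monochromatic_def Field_def)
  have "acyclic_digraph (?D \<restriction> {v \<in> verts ?D. c v = i}) \<longleftrightarrow>
      acyclic {(u, v) \<in> monochromatic R c. c u = i \<and> c v = i}" for i
  proof -
    interpret H: wf_digraph "?D \<restriction> {v \<in> verts ?D. c v = i}"
      by (rule wellformed_induce_subgraph) 
    show ?thesis by (simp add: H.acyclic_digraph_iff_acyclic ends)
  qed
  moreover have "(\<forall>i\<in>{1..k}. acyclic {(u, v) \<in> monochromatic R c. c u = i \<and> c v = i}) \<longleftrightarrow> acyclic (monochromatic R c)"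
    if c: "c ` V \<subseteq> {1..k}"
  proof
    assume *: "\<forall>i\<in>{1..k}. acyclic {(u, v) \<in> monochromatic R c. c u = i \<and> c v = i}"
    show "acyclic (monochromatic R c)"
    proof (rule acyclic_fibres[where r = c])
      fix i
      show "acyclic {(u, v) \<in> monochromatic R c. c u = i \<and> c v = i}"
      proof (cases "i \<in> {1..k}")
        case False
        have "{(u, v) \<in> monochromatic R c. c u = i \<and> c v = i} = {}"
        proof -
          have "c u \<in> {1..k}" if "(u, v) \<in> R" for u v
            using FieldI1[OF that] assms c by blast
          with False show ?thesis by (auto simp: monochromatic_def)
        qed
        then show ?thesis by (simp only: acyclic_def trancl_empty) simp
      qed (use * in blast)
    qed (auto simp: monochromatic_def)
  qed (auto intro: acyclic_subset)
  ultimately show ?thesis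
    unfolding dicolouring_def by (auto simp: rel_digraph_def)
qed

lemma ex_dicolouring_rel_digraph_iff:
  assumes "Field R \<subseteq> V" "k \<ge> 1"
  shows "(\<exists>c. dicolouring (rel_digraph V R) k c) \<longleftrightarrow> colourable R k"
proof
  assume "\<exists>c. dicolouring (rel_digraph V R) k c"
  then obtain c where "c ` V \<subseteq> {1..k}" "acyclic (monochromatic R c)"
    using dicolouring_rel_digraph_iff[OF assms(1)] by blast
  then show "colourable R k"
    using assms by (intro colourable_from_set[where S = "{1..k}"]) auto
next
  assume "colourable R k"
  from colourable_into_set[OF this, of "{1..k}"]
  show "\<exists>c. dicolouring (rel_digraph V R) k c"
    unfolding dicolouring_rel_digraph_iff[OF assms(1)] by (auto simp: image_subset_iff)
qed

lemma dicolouring_mono: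
  assumes "dicolouring (rel_digraph V R) k c" "Field R \<subseteq> V" "k \<le> l"
  shows "dicolouring (rel_digraph V R) l c"
proof -
  have "{1..k} \<subseteq> {1..l}" using assms(3) by simp
  with assms(1) show ?thesis
    unfolding dicolouring_rel_digraph_iff[OF assms(2)] by blast
qed

lemma dicritical_rel_digraph:
  assumes R: "critical k R" and k: "k \<ge> 2"
  shows "oriented_graph (rel_digraph (Field R) R)" "dicritical k (rel_digraph (Field R) R)"
proof -
  let ?D = "rel_digraph (Field R) R"
  have asy: "(v, u) \<notin> R" if "(u, v) \<in> R" for u v using R that by (auto simp: critical_def)
  interpret wf_digraph ?D by (rule wf_rel_digraph) simp
  have dig: "digraph ?D"
    by unfold_locales
      (use R asy[of x x for x] in \<open>auto simp: rel_digraph_def critical_def arc_to_ends_def intro: finite_Field\<close>)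
  have ends: "arcs_ends ?D = R" by (auto simp: arcs_ends_conv rel_digraph_def)
  show "oriented_graph ?D" unfolding oriented_graph_def ends using dig asy by blast
  have "dichromatic_number ?D = k" unfolding dichromatic_number_def
  proof (rule Least_equality)
    show "\<exists>c. dicolouring ?D k c"
      using critical_colourable[OF R k] k by (subst ex_dicolouring_rel_digraph_iff) auto
    fix l assume l: "\<exists>c. dicolouring ?D l c"
    show "k \<le> l"
    proof (rule ccontr)
      assume "\<not> k \<le> l"
      with l have "\<exists>c. dicolouring ?D (k - 1) c"
        using dicolouring_mono[of "Field R" R l _ "k - 1", OF _ order_refl] by fastforce
      then have "colourable R (k - 1)" using k by (subst (asm) ex_dicolouring_rel_digraph_iff) auto
      with R show False by (simp add: critical_def)
    qed
  qed
  moreover have "dichromatic_number H < k"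
    if H: "subgraph H ?D" "verts H \<noteq> verts ?D \<or> arcs H \<noteq> arcs ?D" for H
  proof -
    have tl: "tail H = fst" "head H = snd" and sub: "verts H \<subseteq> Field R" "arcs H \<subseteq> R"
      using H(1) by (auto simp: subgraph_def compatible_def rel_digraph_def)
    have eq: "H = rel_digraph (verts H) (arcs H)" by (simp add: rel_digraph_def tl[symmetric])
    interpret H: wf_digraph H using H(1) by (auto simp: subgraph_def)
    have F: "Field (arcs H) \<subseteq> verts H"
      using H.head_in_verts H.tail_in_verts by (force simp: Field_def tl)
    have "arcs H \<noteq> R"
    proof
      assume "arcs H = R"
      with F sub H(2) show False by (auto simp: rel_digraph_def)
    qed
    \<comment> \<open>A proper subdigraph therefore misses an arc.\<close>
    then obtain e where e: "e \<in> R" "arcs H \<subseteq> R - {e}" using sub by blast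
    then have "colourable (R - {e}) (k - 1)" using R by (simp add: critical_def)
    then have "colourable (arcs H) (k - 1)"
      by (rule colourable_hom[of _ _ _ id]) (use e in auto)
    then have "\<exists>c. dicolouring H (k - 1) c"
      using ex_dicolouring_rel_digraph_iff[OF F, of "k - 1"] k eq by auto
    then have "dichromatic_number H \<le> k - 1"
      unfolding dichromatic_number_def by (rule Least_le)
    with k show ?thesis by simp
  qed
  ultimately show "dicritical k ?D" unfolding dicritical_def using dig by blast
qed

theorem theorem4p4:
  fixes k :: nat
  assumes "k \<ge> 2"
  shows "\<exists>N::nat. \<forall>n\<ge>N. \<exists>D :: (nat, nat \<times> nat) pre_digraph.
    oriented_graph D \<and> dicritical k D \<and> card (verts D) = n \<and>
    int (card (arcs D)) \<le> (2 * int k - 3) * int n \<and>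
    (k > 2 \<longrightarrow> int (card (arcs D)) < (2 * int k - 3) * int n)"
proof -
  obtain N where N: "\<forall>n\<ge>N. \<exists>A :: (nat \<times> nat) set. critical k A \<and> card (Field A) = n \<and>
    int (card A) \<le> (2 * int k - 3) * int n \<and>
    (k > 2 \<longrightarrow> int (card A) < (2 * int k - 3) * int n)"
    using ex_sparse_critical[OF assms] by blast
  show ?thesis
  proof (intro exI[of _ N] allI impI)
    fix n assume "n \<ge> N"
    with N obtain A :: "(nat \<times> nat) set" where A: "critical k A" "card (Field A) = n"
      "int (card A) \<le> (2 * int k - 3) * int n"
      "k > 2 \<longrightarrow> int (card A) < (2 * int k - 3) * int n" by blast
    show "\<exists>D :: (nat, nat \<times> nat) pre_digraph.
      oriented_graph D \<and> dicritical k D \<and> card (verts D) = n \<and>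
      int (card (arcs D)) \<le> (2 * int k - 3) * int n \<and>
      (k > 2 \<longrightarrow> int (card (arcs D)) < (2 * int k - 3) * int n)"
      by (rule exI[of _ "rel_digraph (Field A) A"])
        (use A dicritical_rel_digraph[OF A(1) assms] in \<open>simp add: rel_digraph_def\<close>)
  qed
qed

end
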